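(* If $R$ is a ceer such that $R\equiv_{\mathrm{c}} R\oplus \Id_\omega$, then there is a c.e.\ semigroup $S$ generated by two elements such that ${=_S}\equiv_{\mathrm{c}} R$.
   Context: A ceer is a computably enumerable equivalence relation on $\omega$. For equivalence relations $R,S$ on $\omega$, $R\le_{\mathrm{c}} S$ means there is a computable $f$ with $x\mathrel{R}y\Leftrightarrow f(x)\mathrel{S}f(y)$; $R\equiv_{\mathrm{c}} S$ means both $R\le_{\mathrm{c}} S$ and $S\le_{\mathrm{c}} R$. $\Id_\omega$ is the equality relation on $\omega$. The uniform join of $U,V$ is $U\oplus V=\{(2x,2y):x\mathrel{U}y\}\cup\{(2x+1,2y+1):x\mathrel{V}y\}$. A two-generator c.e.\ semigroup $S$ is a quotient of the free semigroup $X^+$ on $X=\{a,b\}$ (identified with $\omega$ via a fixed computable coding) by a congruence $=_S$ which is c.e.; $=_S$ is its word problem. *)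

theory Defs
  imports Main
begin

text \<open>Descriptions of the partial \<open>\<mu>\<close>-recursive functions. Descriptions carry no arity:
  \<open>Zero\<close> accepts argument lists of any length, while arguments missing for \<open>Succ\<close>, \<open>Proj\<close> or
  \<open>Prec\<close> make the evaluation undefined.\<close>

datatype recf =
    Zero
  | Succ
  | Proj nat
  | Comp recf "recf list"
  | Prec recf recf
  | Mu recf

fun reval :: "recf \<Rightarrow> nat list \<Rightarrow> nat option" where
  "reval Zero xs = Some 0"
| "reval Succ xs = (case xs of [x] \<Rightarrow> Some (Suc x) | _ \<Rightarrow> None)"
| "reval (Proj i) xs = (if i < length xs then Some (xs ! i) else None)"
| "reval (Comp f gs) xs =
    (let ys = map (\<lambda>g. reval g xs) gs
     in if None \<in> set ys then None else reval f (map the ys))"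
| "reval (Prec f g) xs =
    (case xs of
       [] \<Rightarrow> None
     | n # zs \<Rightarrow>
         rec_nat (reval f zs) (\<lambda>m r. Option.bind r (\<lambda>y. reval g (m # y # zs))) n)"
| "reval (Mu f) xs =
    (let hit = (\<lambda>n. reval f (n # xs) = Some 0 \<and>
                    (\<forall>m<n. \<exists>y. reval f (m # xs) = Some (Suc y)))
     in if \<exists>n. hit n then Some (LEAST n. hit n) else None)"

definition computable :: "(nat \<Rightarrow> nat) \<Rightarrow> bool" where
  "computable f \<longleftrightarrow> (\<exists>r. \<forall>x. reval r [x] = Some (f x))"

definition ce_rel :: "(nat \<times> nat) set \<Rightarrow> bool" where
  "ce_rel R \<longleftrightarrow> (\<exists>r. \<forall>x y. (x, y) \<in> R \<longleftrightarrow> reval r [x, y] \<noteq> None)"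

definition ceer :: "(nat \<times> nat) set \<Rightarrow> bool" where
  "ceer R \<longleftrightarrow> equiv UNIV R \<and> ce_rel R"

definition c_reducible :: "(nat \<times> nat) set \<Rightarrow> (nat \<times> nat) set \<Rightarrow> bool"
    (infix \<open>\<le>\<^sub>c\<close> 50) where
  "R \<le>\<^sub>c S \<longleftrightarrow> (\<exists>f. computable f \<and> (\<forall>x y. (x, y) \<in> R \<longleftrightarrow> (f x, f y) \<in> S))"

definition c_equivalent :: "(nat \<times> nat) set \<Rightarrow> (nat \<times> nat) set \<Rightarrow> bool"
    (infix \<open>\<equiv>\<^sub>c\<close> 50) where
  "R \<equiv>\<^sub>c S \<longleftrightarrow> R \<le>\<^sub>c S \<and> S \<le>\<^sub>c R"

definition uniform_join :: "(nat \<times> nat) set \<Rightarrow> (nat \<times> nat) set \<Rightarrow> (nat \<times> nat) set"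
    (infixl \<open>\<oplus>\<close> 65) where
  "U \<oplus> V = {(2 * x, 2 * y) | x y. (x, y) \<in> U} \<union> {(2 * x + 1, 2 * y + 1) | x y. (x, y) \<in> V}"

datatype letter = GenA | GenB

definition free_semigroup :: "letter list set" where
  "free_semigroup = {w. w \<noteq> []}"

text \<open>Words are numbered by bijective binary notation (digits \<open>1\<close> and \<open>2\<close>, least significant
  digit first); the empty word would get number \<open>0\<close>, hence the shift by one for non-empty words.\<close>

primrec bij_binary :: "letter list \<Rightarrow> nat" where
  "bij_binary [] = 0"
| "bij_binary (x # w) = (case x of GenA \<Rightarrow> 1 | GenB \<Rightarrow> 2) + 2 * bij_binary w"

definition word_code :: "letter list \<Rightarrow> nat" where
  "word_code w = bij_binary w - 1"

definition word_congruence :: "(letter list \<times> letter list) set \<Rightarrow> bool" where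
  "word_congruence E \<longleftrightarrow> equiv free_semigroup E \<and>
     (\<forall>u u' v v'. (u, u') \<in> E \<longrightarrow> (v, v') \<in> E \<longrightarrow> (u @ v, u' @ v') \<in> E)"

record 'a semigroup_struct =
  elems :: "'a set"
  prd :: "'a \<Rightarrow> 'a \<Rightarrow> 'a"

definition quotient_semigroup ::
    "(letter list \<times> letter list) set \<Rightarrow> letter list set semigroup_struct" where
  "quotient_semigroup E =
     \<lparr>elems = free_semigroup // E, prd = (\<lambda>C D. \<Union>u\<in>C. \<Union>v\<in>D. E `` {u @ v})\<rparr>"

text \<open>Elements of a quotient of the free semigroup are classes of words; two words are equal in it
  if they lie in the same class. The relation is transported to the natural numbers.\<close>

definition word_problem :: "letter list set semigroup_struct \<Rightarrow> (nat \<times> nat) set" where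
  "word_problem S = {(word_code u, word_code v) | u v. \<exists>C\<in>elems S. u \<in> C \<and> v \<in> C}"

definition two_generator_ce_semigroup :: "letter list set semigroup_struct \<Rightarrow> bool" where
  "two_generator_ce_semigroup S \<longleftrightarrow>
     (\<exists>E. word_congruence E \<and> S = quotient_semigroup E) \<and> ce_rel (word_problem S)"

lemma inj_bij_binary: "inj bij_binary"
proof (rule injI)
  fix u v
  show "bij_binary u = bij_binary v \<Longrightarrow> u = v"
  proof (induction u arbitrary: v)
    case Nil
    then show ?case by (cases v) (auto split: letter.splits)
  next
    case (Cons x u)
    then obtain y v' where v: "v = y # v'"
      by (cases v) (auto split: letter.splits)
    have "x = y \<and> bij_binary u = bij_binary v'"
      using Cons.prems unfolding v by (cases x; cases y; simp; presburger)
    then show ?case using Cons.IH v by blast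
  qed
qed

lemma surj_bij_binary: "\<exists>w. bij_binary w = n"
proof (induction n rule: less_induct)
  case (less n)
  consider "n = 0" | m where "n = 1 + 2 * m" | m where "n = 2 + 2 * m"
    by (metis One_nat_def Suc_1 add.commute dvd_def mult_Suc_right not0_implies_Suc oddE
        mult_0_right)
  then show ?case
  proof cases
    case 1
    then have "bij_binary [] = n" by simp
    then show ?thesis ..
  next
    case (2 m)
    then obtain w where "bij_binary w = m" using less[of m] by auto
    with 2 have "bij_binary (GenA # w) = n" by simp
    then show ?thesis ..
  next
    case (3 m)
    then obtain w where "bij_binary w = m" using less[of m] by auto
    with 3 have "bij_binary (GenB # w) = n" by simp
    then show ?thesis ..
  qed
qed

lemma bij_binary_pos: "w \<noteq> [] \<Longrightarrow> bij_binary w > 0"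
  by (cases w) (auto split: letter.splits)

lemma bij_betw_word_code: "bij_betw word_code free_semigroup UNIV"
  unfolding bij_betw_def
proof
  show "inj_on word_code free_semigroup"
  proof (rule inj_onI)
    fix u v assume "u \<in> free_semigroup" "v \<in> free_semigroup" "word_code u = word_code v"
    then have "bij_binary u = bij_binary v"
      using bij_binary_pos[of u] bij_binary_pos[of v]
      by (simp add: free_semigroup_def word_code_def)
    then show "u = v" using inj_bij_binary by (simp add: inj_def)
  qed
  show "word_code ` free_semigroup = UNIV"
  proof (intro equalityI subsetI UNIV_I)
    fix n :: nat
    obtain w where w: "bij_binary w = Suc n" using surj_bij_binary by blast
    then have "w \<in> free_semigroup" "word_code w = n"
      by (auto simp: free_semigroup_def word_code_def)
    then show "n \<in> word_code ` free_semigroup" by blast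
  qed
qed

lemma word_problem_quotient:
  assumes "word_congruence E"
  shows "word_problem (quotient_semigroup E) = {(word_code u, word_code v) | u v. (u, v) \<in> E}"
proof -
  have E: "equiv free_semigroup E" using assms by (simp add: word_congruence_def)
  have "(\<exists>C\<in>free_semigroup // E. u \<in> C \<and> v \<in> C) \<longleftrightarrow> (u, v) \<in> E" for u v
  proof
    assume "\<exists>C\<in>free_semigroup // E. u \<in> C \<and> v \<in> C"
    then show "(u, v) \<in> E" using quotient_eq_iff[OF E] by blast
  next
    assume uv: "(u, v) \<in> E"
    then have "u \<in> free_semigroup" using E by (metis equiv_class_eq_iff)
    then have "E `` {u} \<in> free_semigroup // E" "u \<in> E `` {u}" "v \<in> E `` {u}"
      using uv by (simp_all add: quotientI equiv_class_self[OF E, unfolded Image_singleton_iff])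
    then show "\<exists>C\<in>free_semigroup // E. u \<in> C \<and> v \<in> C" by blast
  qed
  then show ?thesis by (simp add: word_problem_def quotient_semigroup_def)
qed

lemma quotient_prd:
  assumes "word_congruence E" "u \<in> free_semigroup" "v \<in> free_semigroup"
  shows "prd (quotient_semigroup E) (E `` {u}) (E `` {v}) = E `` {u @ v}"
proof -
  have E: "equiv free_semigroup E"
    and cong: "\<And>u u' v v'. (u, u') \<in> E \<Longrightarrow> (v, v') \<in> E \<Longrightarrow> (u @ v, u' @ v') \<in> E"
    using assms(1) by (auto simp: word_congruence_def)
  have "E `` {u' @ v'} = E `` {u @ v}" if "u' \<in> E `` {u}" "v' \<in> E `` {v}" for u' v'
    using that cong equiv_class_eq[OF E] by blast
  moreover have "u \<in> E `` {u}" "v \<in> E `` {v}"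
    using equiv_class_self[OF E] assms(2,3) by blast+
  ultimately have "(\<Union>u'\<in>E `` {u}. \<Union>v'\<in>E `` {v}. E `` {u' @ v'}) = E `` {u @ v}" by blast
  then show ?thesis by (simp add: quotient_semigroup_def)
qed

end

theory Submission
  imports Defs
begin

text \<open>Let \<open>w\<^sub>n = b a\<^sup>n b\<close>. Identify \<open>w\<^sub>m\<close> with \<open>w\<^sub>n\<close> whenever \<open>m R n\<close>, collapse all other words
  with at least two letters \<open>b\<close> to a zero element, and identify nothing else. This is a congruence:
  a product of two non-empty words, one of which contains two letters \<open>b\<close>, is never of the form
  \<open>w\<^sub>n\<close>, so distinct identified words have equal (zero) products with everything. The map
  \<open>n \<mapsto> w\<^sub>n\<close> reduces \<open>R\<close> to the word problem, and sending \<open>w\<^sub>n\<close> to \<open>2n\<close>, zero words to \<open>1\<close> and any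
  other word to an odd number of its own reduces the word problem to \<open>R \<oplus> Id\<close>, hence to \<open>R\<close>.\<close>

section \<open>Closure properties of recursive functions\<close>

text \<open>Argument lists of fixed length \<open>k\<close> make the entries \<open>xs ! i\<close>
  play the role of variables, so that computability of a term can be proved by following its syntax
  with introduction rules.\<close>

definition recursive_on :: "nat \<Rightarrow> (nat list \<Rightarrow> nat) \<Rightarrow> bool" where
  "recursive_on k F \<longleftrightarrow> (\<exists>r. \<forall>xs. length xs = k \<longrightarrow> reval r xs = Some (F xs))"

definition computable2 :: "(nat \<Rightarrow> nat \<Rightarrow> nat) \<Rightarrow> bool" where
  "computable2 f \<longleftrightarrow> (\<exists>r. \<forall>x y. reval r [x, y] = Some (f x y))"

lemma computableI: "recursive_on 1 (\<lambda>xs. f (xs ! 0)) \<Longrightarrow> computable f"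
  unfolding recursive_on_def computable_def
  by (metis One_nat_def length_Cons list.size(3) nth_Cons_0)

lemma computable2I: "recursive_on 2 (\<lambda>xs. f (xs ! 0) (xs ! 1)) \<Longrightarrow> computable2 f"
  unfolding recursive_on_def computable2_def
  by (metis One_nat_def Suc_1 length_Cons list.size(3) nth_Cons_0 nth_Cons_Suc)

lemma recursive_on_nth: "i < k \<Longrightarrow> recursive_on k (\<lambda>xs. xs ! i)"
  unfolding recursive_on_def by (rule exI[of _ "Proj i"]) simp

lemma recursive_on_comp:
  assumes "computable f" "recursive_on k F"
  shows "recursive_on k (\<lambda>xs. f (F xs))"
proof -
  obtain r s where "\<forall>x. reval r [x] = Some (f x)" "\<forall>xs. length xs = k \<longrightarrow> reval s xs = Some (F xs)"
    using assms unfolding computable_def recursive_on_def by blast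
  then show ?thesis
    unfolding recursive_on_def by (intro exI[of _ "Comp r [s]"]) simp
qed

lemma recursive_on_comp2:
  assumes "computable2 f" "recursive_on k F" "recursive_on k G"
  shows "recursive_on k (\<lambda>xs. f (F xs) (G xs))"
proof -
  obtain r s t where "\<forall>x y. reval r [x, y] = Some (f x y)"
    "\<forall>xs. length xs = k \<longrightarrow> reval s xs = Some (F xs)"
    "\<forall>xs. length xs = k \<longrightarrow> reval t xs = Some (G xs)"
    using assms unfolding computable2_def recursive_on_def by blast
  then show ?thesis
    unfolding recursive_on_def by (intro exI[of _ "Comp r [s, t]"]) simp
qed

lemma computable_Suc: "computable Suc"
  unfolding computable_def by (rule exI[of _ Succ]) simp

lemmas recursive_on_Suc = recursive_on_comp[OF computable_Suc]

lemma recursive_on_const: "recursive_on k (\<lambda>_. c)"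
proof (induction c)
  case 0
  show ?case unfolding recursive_on_def by (rule exI[of _ Zero]) simp
qed (rule recursive_on_Suc)

lemma computable2_rec_nat:
  assumes "computable a" "recursive_on 3 (\<lambda>xs. h (xs ! 0) (xs ! 1) (xs ! 2))"
  shows "computable2 (\<lambda>x n. rec_nat (a x) (\<lambda>m y. h m y x) n)"
proof -
  obtain r s where r: "\<And>x. reval r [x] = Some (a x)"
    and "\<forall>xs. length xs = 3 \<longrightarrow> reval s xs = Some (h (xs ! 0) (xs ! 1) (xs ! 2))"
    using assms unfolding computable_def recursive_on_def by blast
  then have s: "reval s [m, y, x] = Some (h m y x)" for m y x by simp
  have "reval (Prec r s) [n, x] = Some (rec_nat (a x) (\<lambda>m y. h m y x) n)" for n x
    by (induction n) (simp_all add: r s)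
  then show ?thesis
    \<comment> \<open>\<open>Prec\<close> recurses on the head of its argument list, whereas the
      recursion variable here is the second argument; the two projections swap them.\<close>
    unfolding computable2_def by (intro exI[of _ "Comp (Prec r s) [Proj 1, Proj 0]"]) simp
qed

lemma computable_rec_nat:
  assumes "recursive_on 3 (\<lambda>xs. h (xs ! 0) (xs ! 1))"
  shows "computable (rec_nat c h)"
proof -
  \<comment> \<open>A parameter-free recursion is treated as one with a dummy parameter, which is
    set to \<open>0\<close> afterwards.\<close>
  have "computable2 (\<lambda>x n. rec_nat c (\<lambda>m y. h m y) n)"
    using assms by (intro computable2_rec_nat computableI recursive_on_const)
  then show ?thesis
    by (intro computableI recursive_on_comp2[where f = "\<lambda>x. rec_nat c h" and F = "\<lambda>_. 0"]
        recursive_on_const recursive_on_nth) simp_all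
qed

section \<open>Elementary arithmetic functions and case distinctions\<close>

lemma computable_id: "computable (\<lambda>x. x)"
  by (rule computableI) (simp add: recursive_on_nth)

lemma computable2_add: "computable2 (+)"
proof -
  have "computable2 (\<lambda>x n. rec_nat x (\<lambda>m y. Suc y) n)"
    by (intro computable2_rec_nat computable_id recursive_on_Suc recursive_on_nth) simp
  moreover have "rec_nat x (\<lambda>m y. Suc y) n = x + n" for x n by (induction n) auto
  ultimately show ?thesis by simp
qed

lemmas recursive_on_add = recursive_on_comp2[OF computable2_add]

lemma computable2_mult: "computable2 (*)"
proof -
  have "computable2 (\<lambda>x n. rec_nat 0 (\<lambda>m y. y + x) n)"
    by (intro computable2_rec_nat computableI recursive_on_const recursive_on_add recursive_on_nth)
      simp_all
  moreover have "rec_nat 0 (\<lambda>m y. y + x) n = x * n" for x n :: nat by (induction n) auto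
  ultimately show ?thesis by simp
qed

lemmas recursive_on_mult = recursive_on_comp2[OF computable2_mult]

lemma computable2_diff: "computable2 (-)"
proof -
  \<comment> \<open>This recursion is the predecessor function; iterating it yields truncated
    subtraction.\<close>
  have "computable (rec_nat 0 (\<lambda>m y. m))"
    by (intro computable_rec_nat recursive_on_nth) simp
  then have "computable2 (\<lambda>x n. rec_nat x (\<lambda>m y. rec_nat 0 (\<lambda>m y. m) y) n)"
    by (intro computable2_rec_nat computable_id
        recursive_on_comp[where f = "rec_nat 0 (\<lambda>m y. m)"] recursive_on_nth) simp_all
  moreover have pred: "rec_nat 0 (\<lambda>m y. m) y = y - 1" for y :: nat by (cases y) auto
  have "rec_nat x (\<lambda>m y. rec_nat 0 (\<lambda>m y. m) y) n = x - n" for x n :: nat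
    by (induction n) (auto simp: pred)
  ultimately show ?thesis by simp
qed

lemmas recursive_on_diff = recursive_on_comp2[OF computable2_diff]

lemma recursive_on_if_le:
  assumes "recursive_on k F" "recursive_on k G" "recursive_on k H" "recursive_on k J"
  shows "recursive_on k (\<lambda>xs. if F xs \<le> G xs then H xs else J xs)"
proof -
  \<comment> \<open>With truncated subtraction, \<open>1 - (F xs - G xs)\<close> is \<open>1\<close>
    if \<open>F xs \<le> G xs\<close> and \<open>0\<close> otherwise.\<close>
  have "(\<lambda>xs. if F xs \<le> G xs then H xs else J xs) =
      (\<lambda>xs. (1 - (F xs - G xs)) * H xs + (1 - (1 - (F xs - G xs))) * J xs)"
    by (rule ext) auto
  then show ?thesis
    by (simp only:)
      (intro recursive_on_add recursive_on_mult recursive_on_diff recursive_on_const assms)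
qed

lemma recursive_on_if_eq:
  assumes "recursive_on k F" "recursive_on k G" "recursive_on k H" "recursive_on k J"
  shows "recursive_on k (\<lambda>xs. if F xs = G xs then H xs else J xs)"
proof -
  have "(\<lambda>xs. if F xs = G xs then H xs else J xs) =
      (\<lambda>xs. if F xs \<le> G xs then if G xs \<le> F xs then H xs else J xs else J xs)"
    by (rule ext) auto
  then show ?thesis
    by (simp only:) (intro recursive_on_if_le assms)
qed

lemma computable_mod2: "computable (\<lambda>n. n mod 2)"
proof -
  have "computable (rec_nat 0 (\<lambda>m y. 1 - y))"
    by (intro computable_rec_nat recursive_on_diff recursive_on_const recursive_on_nth) simp
  moreover have "rec_nat 0 (\<lambda>m y. 1 - y) = (\<lambda>n :: nat. n mod 2)"
  proof
    show "rec_nat 0 (\<lambda>m y. 1 - y) n = n mod 2" for n :: nat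
      by (induction n) (auto simp: mod_Suc)
  qed
  ultimately show ?thesis by simp
qed

lemma computable_div2: "computable (\<lambda>n. n div 2)"
proof -
  \<comment> \<open>Passing from \<open>m\<close> to \<open>Suc m\<close> raises the half exactly
    when \<open>m\<close> is odd.\<close>
  have "computable (rec_nat 0 (\<lambda>m y. y + m mod 2))"
    by (intro computable_rec_nat recursive_on_add recursive_on_comp[OF computable_mod2]
        recursive_on_nth) simp_all
  moreover have "rec_nat 0 (\<lambda>m y. y + m mod 2) = (\<lambda>n :: nat. n div 2)"
  proof
    show "rec_nat 0 (\<lambda>m y. y + m mod 2) n = n div 2" for n :: nat
      by (induction n) (simp, simp, presburger)
  qed
  ultimately show ?thesis by simp
qed

lemma computable2_div_power2: "computable2 (\<lambda>x k. x div 2 ^ k)"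
proof -
  have "computable2 (\<lambda>x n. rec_nat x (\<lambda>m y. y div 2) n)"
    by (intro computable2_rec_nat computable_id recursive_on_comp[OF computable_div2]
        recursive_on_nth) simp
  moreover have "rec_nat x (\<lambda>m y. y div 2) n = x div 2 ^ n" for x n :: nat
    by (induction n) (simp_all add: power_Suc2 div_mult2_eq del: power_Suc)
  ultimately show ?thesis by simp
qed

definition binary_digit_sum :: "nat \<Rightarrow> nat \<Rightarrow> nat" where
  "binary_digit_sum x n = (\<Sum>k<n. x div 2 ^ k mod 2)"

lemma computable2_binary_digit_sum: "computable2 binary_digit_sum"
proof -
  have "computable2 (\<lambda>x n. rec_nat 0 (\<lambda>m y. y + x div 2 ^ m mod 2) n)"
    by (intro computable2_rec_nat computableI recursive_on_const recursive_on_add recursive_on_nth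
        recursive_on_comp[OF computable_mod2] recursive_on_comp2[OF computable2_div_power2])
      simp_all
  moreover have "rec_nat 0 (\<lambda>m y. y + x div 2 ^ m mod 2) n = binary_digit_sum x n" for x n
    unfolding binary_digit_sum_def by (induction n) auto
  ultimately show ?thesis by simp
qed

section \<open>Reductions between relations\<close>

lemma c_reducible_trans:
  assumes "R \<le>\<^sub>c S" "S \<le>\<^sub>c T"
  shows "R \<le>\<^sub>c T"
proof -
  obtain f g where f: "computable f" "\<And>x y. (x, y) \<in> R \<longleftrightarrow> (f x, f y) \<in> S"
    and g: "computable g" "\<And>x y. (x, y) \<in> S \<longleftrightarrow> (g x, g y) \<in> T"
    using assms unfolding c_reducible_def by blast
  have "computable (\<lambda>x. g (f x))"
    by (intro computableI recursive_on_comp[OF g(1)] recursive_on_comp[OF f(1)] recursive_on_nth)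
      simp
  then show ?thesis using f(2) g(2) unfolding c_reducible_def by blast
qed

lemma ce_rel_c_reducible:
  assumes "R \<le>\<^sub>c S" "ce_rel S"
  shows "ce_rel R"
proof -
  obtain f r s where f: "\<And>x y. (x, y) \<in> R \<longleftrightarrow> (f x, f y) \<in> S" "\<And>x. reval r [x] = Some (f x)"
    and s: "\<And>x y. (x, y) \<in> S \<longleftrightarrow> reval s [x, y] \<noteq> None"
    using assms unfolding c_reducible_def computable_def ce_rel_def by metis
  have "reval (Comp s [Comp r [Proj 0], Comp r [Proj 1]]) [x, y] = reval s [f x, f y]" for x y
    by (simp add: f(2))
  then show ?thesis using f(1) s unfolding ce_rel_def by metis
qed

section \<open>The semigroup\<close>

definition coding_word :: "nat \<Rightarrow> letter list" where
  "coding_word n = GenB # replicate n GenA @ [GenB]"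

text \<open>The offset \<open>3\<close> keeps the third kind of key odd and distinct from the
  \<open>1\<close> reserved for zero.\<close>

definition word_key :: "letter list \<Rightarrow> nat" where
  "word_key w =
     (if \<exists>n. w = coding_word n then 2 * (THE n. w = coding_word n)
      else if count_list w GenB \<le> 1 then 2 * word_code w + 3
      else 1)"

text \<open>As a pullback along \<open>word_key\<close> this inherits being an equivalence from the
  join; only compatibility with concatenation needs combinatorics of words.\<close>

definition key_congruence :: "(nat \<times> nat) set \<Rightarrow> (letter list \<times> letter list) set" where
  "key_congruence R =
     {(u, v). u \<noteq> [] \<and> v \<noteq> [] \<and> (word_key u, word_key v) \<in> R \<oplus> Id}"

lemma coding_word_inject: "coding_word m = coding_word n \<longleftrightarrow> m = n"
  unfolding coding_word_def by (auto dest: arg_cong[of _ _ length])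

lemma word_key_coding_word: "word_key (coding_word n) = 2 * n"
  unfolding word_key_def by (auto simp: coding_word_inject)

lemma count_list_replicate: "count_list (replicate n x) y = (if x = y then n else 0)"
  by (induction n) auto

lemma count_coding_word: "count_list (coding_word n) GenB = 2"
  unfolding coding_word_def by (simp add: count_list_replicate)

text \<open>A coding word begins and ends with \<open>GenB\<close> and has no other occurrence of
  it, so a splitting into two non-empty factors leaves each factor exactly one.\<close>

lemma append_neq_coding_word:
  assumes "u \<noteq> []" "v \<noteq> []" "2 \<le> count_list u GenB \<or> 2 \<le> count_list v GenB"
  shows "u @ v \<noteq> coding_word n"
proof
  assume eq: "u @ v = coding_word n"
  have "count_list u GenB + count_list v GenB = 2"
    using arg_cong[OF eq, of "\<lambda>w. count_list w GenB"] by (simp add: count_coding_word)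
  moreover have "hd u = GenB"
    using arg_cong[OF eq, of hd] assms(1) by (simp add: coding_word_def)
  then have "count_list u GenB \<noteq> 0"
    using hd_in_set[OF assms(1)] by (auto simp: count_list_0_iff)
  moreover have "last v = GenB"
    using arg_cong[OF eq, of last] assms(2) by (simp add: coding_word_def)
  then have "count_list v GenB \<noteq> 0"
    using last_in_set[OF assms(2)] by (auto simp: count_list_0_iff)
  ultimately show False using assms(3) by auto
qed

lemma word_key_append:
  assumes "u \<noteq> []" "v \<noteq> []" "2 \<le> count_list u GenB \<or> 2 \<le> count_list v GenB"
  shows "word_key (u @ v) = 1"
  using append_neq_coding_word[OF assms] assms(3) unfolding word_key_def by auto

lemma word_code_inject: "u \<noteq> [] \<Longrightarrow> v \<noteq> [] \<Longrightarrow> word_code u = word_code v \<longleftrightarrow> u = v"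
  using bij_betw_word_code unfolding bij_betw_def free_semigroup_def by (auto dest: inj_onD)

lemma uniform_join_Id_iff:
  "(x, y) \<in> R \<oplus> Id \<longleftrightarrow> odd x \<and> x = y \<or> even x \<and> even y \<and> (x div 2, y div 2) \<in> R"
  unfolding uniform_join_def by (auto elim!: evenE oddE) presburger+

lemma equiv_uniform_join_Id: "equiv UNIV R \<Longrightarrow> equiv UNIV (R \<oplus> Id)"
proof (rule equivI)
  assume R: "equiv UNIV R"
  show "R \<oplus> Id \<subseteq> UNIV \<times> UNIV" by simp
  show "refl (R \<oplus> Id)"
    using R by (simp add: equiv_def refl_on_def uniform_join_Id_iff)
  show "sym (R \<oplus> Id)"
    using R by (intro symI) (auto simp: equiv_def uniform_join_Id_iff elim: symE)
  show "trans (R \<oplus> Id)"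
    using R by (intro transI) (auto simp: equiv_def uniform_join_Id_iff elim: transE)
qed

lemma key_congruence_sym:
  assumes "equiv UNIV R" "(u, v) \<in> key_congruence R"
  shows "(v, u) \<in> key_congruence R"
proof -
  have "sym (R \<oplus> Id)" using equiv_uniform_join_Id[OF assms(1)] by (simp add: equiv_def)
  then show ?thesis using assms(2) symD[of "R \<oplus> Id"] by (simp add: key_congruence_def)
qed

text \<open>A word with at most one \<open>GenB\<close> has an odd key, where the join is equality,
  and this key determines the word. Such words are thus identified with nothing else.\<close>

lemma key_congruence_count_ge:
  assumes "(u, v) \<in> key_congruence R" "u \<noteq> v"
  shows "2 \<le> count_list u GenB"
proof (rule ccontr)
  assume c: "\<not> 2 \<le> count_list u GenB"
  then have u: "word_key u = 2 * word_code u + 3"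
    unfolding word_key_def using count_coding_word by fastforce
  then have "word_key v = word_key u"
    using assms(1) by (auto simp: key_congruence_def uniform_join_Id_iff)
  \<comment> \<open>The other branches of \<open>word_key\<close> cannot give this value: one is
    even, the other is \<open>1\<close>.\<close>
  then have "word_code v = word_code u"
    unfolding u by (auto simp: word_key_def split: if_splits) presburger
  then show False
    using assms word_code_inject by (auto simp: key_congruence_def)
qed

lemma word_congruence_key_congruence:
  assumes "equiv UNIV R"
  shows "word_congruence (key_congruence R)"
  unfolding word_congruence_def
proof (intro conjI allI impI)
  have join: "refl (R \<oplus> Id)" "trans (R \<oplus> Id)"
    using equiv_uniform_join_Id[OF assms] by (simp_all add: equiv_def)
  show "equiv free_semigroup (key_congruence R)"
  proof (rule equivI)
    show "key_congruence R \<subseteq> free_semigroup \<times> free_semigroup"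
      by (auto simp: key_congruence_def free_semigroup_def)
    show "refl_on free_semigroup (key_congruence R)"
      using join(1) by (auto simp: refl_on_def key_congruence_def free_semigroup_def)
    show "sym (key_congruence R)"
      using key_congruence_sym[OF assms] by (rule symI)
    show "trans (key_congruence R)"
      using transD[OF join(2)] by (intro transI) (fastforce simp: key_congruence_def)
  qed
next
  fix u u' v v' assume *: "(u, u') \<in> key_congruence R" "(v, v') \<in> key_congruence R"
  then have ne: "u \<noteq> []" "u' \<noteq> []" "v \<noteq> []" "v' \<noteq> []"
    by (auto simp: key_congruence_def)
  \<comment> \<open>The products even have equal keys: if either pair of factors differs, both
    products are zero. Reflexivity of the join then suffices.\<close>
  have "word_key (u @ v) = word_key (u' @ v')"
  proof (cases "u = u' \<and> v = v'")
    case False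
    note sym = *[THEN key_congruence_sym[OF assms]]
    consider "u \<noteq> u'" | "v \<noteq> v'" using False by blast
    then show ?thesis
    proof cases
      case 1
      then have "2 \<le> count_list u GenB" "2 \<le> count_list u' GenB"
        using key_congruence_count_ge[OF *(1)] key_congruence_count_ge[OF sym(1)] by simp_all
      then show ?thesis using ne by (simp add: word_key_append)
    next
      case 2
      then have "2 \<le> count_list v GenB" "2 \<le> count_list v' GenB"
        using key_congruence_count_ge[OF *(2)] key_congruence_count_ge[OF sym(2)] by simp_all
      then show ?thesis using ne by (simp add: word_key_append)
    qed
  qed simp
  then show "(u @ v, u' @ v') \<in> key_congruence R"
    using equiv_uniform_join_Id[OF assms] ne
    by (simp add: key_congruence_def equiv_def refl_on_def)
qed

section \<open>Computing with codes of words\<close>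

lemma word_code_coding_word: "word_code (coding_word n) = 6 * 2 ^ n - 1"
proof -
  \<comment> \<open>Each prepended \<open>GenA\<close> sends \<open>x\<close> to
    \<open>2 * x + 1\<close>, hence doubles \<open>x + 1\<close>, starting from \<open>3\<close> for
    \<open>[GenB]\<close>.\<close>
  have "bij_binary (replicate n GenA @ [GenB]) + 1 = 3 * 2 ^ n" by (induction n) auto
  then show ?thesis by (simp add: word_code_def coding_word_def)
qed

lemma computable_word_code_coding_word: "computable (\<lambda>n. word_code (coding_word n))"
proof -
  have "computable (rec_nat 5 (\<lambda>m y. Suc (2 * y)))"
    by (intro computable_rec_nat recursive_on_Suc recursive_on_mult recursive_on_const
        recursive_on_nth) simp
  moreover have "rec_nat 5 (\<lambda>m y. Suc (2 * y)) = (\<lambda>n. word_code (coding_word n))"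
  proof
    fix n
    have "Suc (rec_nat 5 (\<lambda>m y. Suc (2 * y)) n) = 6 * 2 ^ n" by (induction n) auto
    then show "rec_nat 5 (\<lambda>m y. Suc (2 * y)) n = word_code (coding_word n)"
      unfolding word_code_coding_word by simp
  qed
  ultimately show ?thesis by simp
qed

text \<open>Adding a leading digit \<open>1\<close> turns the bijective binary number of a word into an ordinary one:
  the binary digits of \<open>bij_binary w + 1\<close> below the leading one are \<open>0\<close> for \<open>a\<close> and \<open>1\<close> for \<open>b\<close>.\<close>

lemma binary_digit_sum_bij_binary:
  "length w < n \<Longrightarrow> binary_digit_sum (bij_binary w + 1) n = count_list w GenB + 1"
proof (induction w arbitrary: n)
  case Nil
  then obtain m where "n = Suc m" by (cases n) auto
  moreover have "1 div 2 ^ Suc k = (0 :: nat)" for k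
    by (rule div_less) (rule one_less_power, simp_all)
  ultimately show ?case unfolding binary_digit_sum_def
    by (simp add: sum.lessThan_Suc_shift del: sum.lessThan_Suc power_Suc)
next
  case (Cons x w)
  then obtain m where m: "n = Suc m" "length w < m" by (cases n) auto
  have "(bij_binary (x # w) + 1) div 2 ^ Suc k = (bij_binary w + 1) div 2 ^ k" for k
  proof -
    have "(bij_binary (x # w) + 1) div 2 = bij_binary w + 1" by (cases x) simp_all
    then show ?thesis by (metis div_mult2_eq power_Suc)
  qed
  then have "binary_digit_sum (bij_binary (x # w) + 1) n =
      (bij_binary (x # w) + 1) mod 2 + binary_digit_sum (bij_binary w + 1) m"
    unfolding binary_digit_sum_def m(1) sum.lessThan_Suc_shift by simp
  also have "(bij_binary (x # w) + 1) mod 2 = (if x = GenB then 1 else 0)"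
    by (cases x) simp_all
  finally show ?case using Cons.IH[OF m(2)] by simp
qed

lemma length_le_bij_binary: "length w \<le> bij_binary w"
  by (induction w) (auto split: letter.splits)

text \<open>Since \<open>word_code w + 2\<close> is \<open>bij_binary w + 1\<close>, it also bounds
  the number of digits to be inspected. The additional \<open>1\<close> on the left is the leading
  digit.\<close>

lemma count_list_GenB_eq:
  assumes "w \<noteq> []"
  shows "count_list w GenB + 1 = binary_digit_sum (word_code w + 2) (word_code w + 2)"
  using binary_digit_sum_bij_binary[of w "bij_binary w + 1"] length_le_bij_binary[of w]
    bij_binary_pos[OF assms]
  by (simp add: word_code_def)

text \<open>A bounded search for \<open>m < n\<close> such that \<open>x\<close> codes
  \<open>coding_word m\<close>. The value \<open>0\<close> signals failure, so success is recorded
  as \<open>Suc m\<close>.\<close>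

definition decode :: "nat \<Rightarrow> nat \<Rightarrow> nat" where
  "decode x n = rec_nat 0 (\<lambda>m y. if word_code (coding_word m) = x then Suc m else y) n"

lemma computable2_decode: "computable2 decode"
  unfolding decode_def[abs_def]
  by (intro computable2_rec_nat computableI recursive_on_const recursive_on_if_eq recursive_on_Suc
      recursive_on_comp[OF computable_word_code_coding_word] recursive_on_nth) simp_all

lemma decode_coding_word:
  "decode (word_code (coding_word m)) n = (if m < n then Suc m else 0)"
proof -
  have "word_code (coding_word i) = word_code (coding_word j) \<longleftrightarrow> i = j" for i j
    by (metis coding_word_def coding_word_inject list.distinct(1) word_code_inject)
  then show ?thesis unfolding decode_def by (induction n) auto
qed

lemma decode_other:
  "(\<And>m. word_code (coding_word m) \<noteq> x) \<Longrightarrow> decode x n = 0"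
  unfolding decode_def by (induction n) auto

text \<open>The threshold is \<open>2\<close> because the digit sum includes the leading digit
  besides the letters \<open>GenB\<close>.\<close>

definition key_of_code :: "nat \<Rightarrow> nat" where
  "key_of_code x =
     (if decode x x = 0
      then if binary_digit_sum (x + 2) (x + 2) \<le> 2 then 2 * x + 3 else 1
      else 2 * (decode x x - 1))"

lemma computable_key_of_code: "computable key_of_code"
  unfolding key_of_code_def[abs_def]
  by (intro computableI recursive_on_if_eq recursive_on_if_le recursive_on_const recursive_on_add
      recursive_on_mult recursive_on_diff recursive_on_comp2[OF computable2_decode]
      recursive_on_comp2[OF computable2_binary_digit_sum] recursive_on_nth) simp_all

lemma key_of_code_word_code:
  assumes "w \<noteq> []"
  shows "key_of_code (word_code w) = word_key w"
proof (cases "\<exists>n. w = coding_word n")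
  case True
  then obtain n where n: "w = coding_word n" by blast
  \<comment> \<open>The code itself is a sufficient search bound, because it exceeds the index of
    the coding word.\<close>
  have "n < 2 ^ n" by (rule less_exp)
  then have "n < word_code w" unfolding n word_code_coding_word by linarith
  then show ?thesis
    using decode_coding_word[of n "word_code w"] word_key_coding_word[of n]
    by (simp add: n key_of_code_def)
next
  case False
  then have "word_code (coding_word m) \<noteq> word_code w" for m
    using assms word_code_inject[of "coding_word m" w] by (auto simp: coding_word_def)
  then have "decode (word_code w) (word_code w) = 0" by (rule decode_other)
  then show ?thesis
    using False count_list_GenB_eq[OF assms] by (simp add: key_of_code_def word_key_def)
qed

theorem theorem3p3:
  fixes R :: "(nat \<times> nat) set"
  assumes "ceer R"
    and "R \<equiv>\<^sub>c R \<oplus> Id"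
  shows "\<exists>S. two_generator_ce_semigroup S \<and> word_problem S \<equiv>\<^sub>c R"
proof -
  have R: "equiv UNIV R" "ce_rel R" using assms(1) by (simp_all add: ceer_def)
  define S where "S = quotient_semigroup (key_congruence R)"
  have cong: "word_congruence (key_congruence R)"
    using R(1) by (rule word_congruence_key_congruence)
  have wp: "(word_code u, word_code v) \<in> word_problem S \<longleftrightarrow> (word_key u, word_key v) \<in> R \<oplus> Id"
    if "u \<noteq> []" "v \<noteq> []" for u v
    unfolding S_def word_problem_quotient[OF cong]
    using that by (auto simp: key_congruence_def word_code_inject)
  have "(x, y) \<in> word_problem S \<longleftrightarrow> (key_of_code x, key_of_code y) \<in> R \<oplus> Id" for x y
  proof -
    obtain u v where "u \<noteq> []" "v \<noteq> []" "x = word_code u" "y = word_code v"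
      using bij_betw_word_code unfolding bij_betw_def free_semigroup_def by blast
    then show ?thesis using wp key_of_code_word_code by simp
  qed
  then have "word_problem S \<le>\<^sub>c R \<oplus> Id"
    using computable_key_of_code unfolding c_reducible_def by blast
  then have le: "word_problem S \<le>\<^sub>c R"
    using assms(2) c_reducible_trans unfolding c_equivalent_def by blast
  have "(m, n) \<in> R \<longleftrightarrow>
      (word_code (coding_word m), word_code (coding_word n)) \<in> word_problem S" for m n
    using wp[of "coding_word m" "coding_word n"] word_key_coding_word
    by (simp add: uniform_join_Id_iff coding_word_def)
  then have ge: "R \<le>\<^sub>c word_problem S"
    using computable_word_code_coding_word unfolding c_reducible_def by blast
  \<comment> \<open>The word problem is c.e. because it reduces to the c.e. relation
    \<open>R\<close>.\<close>
  have "two_generator_ce_semigroup S"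
    unfolding two_generator_ce_semigroup_def
    using cong S_def ce_rel_c_reducible[OF le R(2)] by blast
  then show ?thesis using le ge unfolding c_equivalent_def by blast
qed

end
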